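(* Let $d\ge 2$ be even. A non-negative binary form $g\in\overline{\mathcal{C}_{d,2}}$ is in $\mathcal{V}_{d,2}$ if and only if $g$ has (real) zeros of order at most $d/2-1$. In particular, $\mathcal{V}_{4,2}=\mathcal{C}_{4,2}$.
   Context: $\mathcal{H}_{d,2}$ is the space of real binary forms (homogeneous polynomials in two variables) of degree $d$. $\mathcal{C}_{d,2}\subset\mathcal{H}_{d,2}$ is the cone of forms strictly positive on $\mathbb{R}^2\setminus\{\mathbf{0}\}$, and its closure $\overline{\mathcal{C}_{d,2}}$ is the cone of forms that are non-negative on $\mathbb{R}^2$. $\mathcal{V}_{d,2}\subset\mathcal{H}_{d,2}$ is the set of forms $g$ whose sublevel set $\{\mathbf{x}\in\mathbb{R}^2: g(\mathbf{x})\le 1\}$ has finite Lebesgue volume. The order of a real zero $(a,b)\in\mathbb{R}^2\setminus\{\mathbf{0}\}$ of $g$ is its multiplicity, i.e. the largest $k$ such that $(bx_1-ax_2)^k$ divides $g$ (infinite if $g$ is the zero form). The condition says that every real zero of $g$ has order at most $d/2-1$. *)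

theory Defs
  imports "HOL-Analysis.Analysis" "HOL-Computational_Algebra.Polynomial" "HOL-Library.Extended_Nat"
begin

text \<open>
  The polynomial ring in two variables is represented as \<open>real poly poly\<close>: the inner
  indeterminate is \<open>x\<^sub>1\<close>, the outer one is \<open>x\<^sub>2\<close>, so the coefficient of
  \<open>x\<^sub>1 ^ i * x\<^sub>2 ^ j\<close> in \<open>p\<close> is \<open>coeff (coeff p j) i\<close>.
\<close>

definition eval2 :: "real poly poly \<Rightarrow> real \<times> real \<Rightarrow> real" where
  "eval2 p x = poly (poly p [:snd x:]) (fst x)"

definition binary_forms :: "nat \<Rightarrow> real poly poly set" where
  "binary_forms d = {p. \<forall>i j. coeff (coeff p j) i \<noteq> 0 \<longrightarrow> i + j = d}"

definition positive_forms :: "nat \<Rightarrow> real poly poly set" where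
  "positive_forms d = {g \<in> binary_forms d. \<forall>x. x \<noteq> (0, 0) \<longrightarrow> eval2 g x > 0}"

text \<open>The closure of \<^term>\<open>positive_forms d\<close> for even \<open>d\<close>; see
  \<open>nonneg_forms_eq_closure\<close> below.\<close>

definition nonneg_forms :: "nat \<Rightarrow> real poly poly set" where
  "nonneg_forms d = {g \<in> binary_forms d. \<forall>x. eval2 g x \<ge> 0}"

definition finite_volume_forms :: "nat \<Rightarrow> real poly poly set" where
  "finite_volume_forms d =
     {g \<in> binary_forms d. emeasure lborel {x :: real \<times> real. eval2 g x \<le> 1} < \<infinity>}"

text \<open>The linear form \<open>b * x\<^sub>1 - a * x\<^sub>2\<close> vanishing on the line through \<open>(a, b)\<close>.\<close>

definition line_form :: "real \<times> real \<Rightarrow> real poly poly" where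
  "line_form z = [:[:0, snd z:], [:- fst z:]:]"

text \<open>The value is \<open>\<infinity>\<close> when all powers divide, in particular for the zero form. (The library's
  \<^const>\<open>multiplicity\<close> would be \<open>0\<close> there.)\<close>

definition zero_order :: "real poly poly \<Rightarrow> real \<times> real \<Rightarrow> enat" where
  "zero_order g z = Sup {enat k | k. line_form z ^ k dvd g}"

lemma eval2_line_form: "eval2 (line_form (a, b)) (x, y) = b * x - a * y"
  by (simp add: eval2_def line_form_def algebra_simps)

lemma eval2_binary_form:
  assumes "p \<in> binary_forms d"
  shows "eval2 p (x, y) = (\<Sum>j\<le>d. coeff (coeff p j) (d - j) * x ^ (d - j) * y ^ j)"
proof -
  have c: "coeff p j = (if j \<le> d then monom (coeff (coeff p j) (d - j)) (d - j) else 0)" for j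
    using assms by (fastforce simp: binary_forms_def poly_eq_iff)
  have "degree p \<le> d"
    by (rule degree_le) (metis c not_le)
  hence "poly p [:y:] = (\<Sum>j\<le>d. coeff p j * [:y:] ^ j)"
    unfolding poly_altdef by (intro sum.mono_neutral_left) (auto simp: coeff_eq_0)
  hence "eval2 p (x, y) = (\<Sum>j\<le>d. poly (coeff p j) x * y ^ j)"
    by (simp add: eval2_def poly_sum)
  also have "\<dots> = (\<Sum>j\<le>d. coeff (coeff p j) (d - j) * x ^ (d - j) * y ^ j)"
    by (rule sum.cong[OF refl], subst c) (simp add: poly_monom)
  finally show ?thesis .
qed

text \<open>The topology on the finite-dimensional space of forms is convergence of coefficients.\<close>

lemma nonneg_forms_eq_closure:
  assumes "even d"
  shows "nonneg_forms d = {g \<in> binary_forms d. \<exists>h. (\<forall>n. h n \<in> positive_forms d) \<and>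
     (\<forall>i j. (\<lambda>n. coeff (coeff (h n) j) i) \<longlonglongrightarrow> coeff (coeff g j) i)}"
proof (intro equalityI subsetI)
  fix g assume g: "g \<in> nonneg_forms d"
  define q :: "real poly poly" where "q = [:monom 1 d:] + monom 1 d"
  define h where "h n = g + smult [:1 / real (Suc n):] q" for n
  have q: "eval2 q x > 0" if "x \<noteq> (0, 0)" for x
  proof -
    have e: "eval2 q x = fst x ^ d + snd x ^ d"
      by (simp add: q_def eval2_def poly_monom)
    have nn: "fst x ^ d \<ge> 0" "snd x ^ d \<ge> 0"
      using assms by (auto simp: zero_le_even_power)
    have "fst x ^ d \<noteq> 0 \<or> snd x ^ d \<noteq> 0"
      using that by (cases x) auto
    with nn show ?thesis
      unfolding e by linarith
  qed
  have "eval2 (h n) x > 0" if "x \<noteq> (0, 0)" for n x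
  proof -
    have "eval2 (h n) x = eval2 g x + 1 / real (Suc n) * eval2 q x"
      by (simp add: h_def eval2_def)
    moreover have "1 / real (Suc n) * eval2 q x > 0"
      using q[OF that] by simp
    moreover have "eval2 g x \<ge> 0"
      using g by (cases x) (simp add: nonneg_forms_def)
    ultimately show ?thesis by linarith
  qed
  moreover have "h n \<in> binary_forms d" for n
  proof -
    have "coeff (coeff (h n) j) i = 0" if "i + j \<noteq> d" for i j
    proof -
      have "coeff (coeff q j) i = 0"
        using that by (auto simp: q_def coeff_pCons split: nat.splits)
      moreover have "coeff (coeff g j) i = 0"
        using g that by (auto simp: nonneg_forms_def binary_forms_def)
      ultimately show ?thesis by (simp add: h_def)
    qed
    thus ?thesis by (auto simp: binary_forms_def)
  qed
  moreover have "(\<lambda>n. coeff (coeff (h n) j) i) \<longlonglongrightarrow> coeff (coeff g j) i" for i j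
  proof -
    have "(\<lambda>n. coeff (coeff g j) i + 1 / real (Suc n) * coeff (coeff q j) i)
        \<longlonglongrightarrow> coeff (coeff g j) i + 0 * coeff (coeff q j) i"
      by (intro tendsto_intros LIMSEQ_Suc[OF lim_1_over_n])
    thus ?thesis by (simp add: h_def)
  qed
  ultimately show "g \<in> {g \<in> binary_forms d. \<exists>h. (\<forall>n. h n \<in> positive_forms d) \<and>
     (\<forall>i j. (\<lambda>n. coeff (coeff (h n) j) i) \<longlonglongrightarrow> coeff (coeff g j) i)}"
    using g by (auto simp: nonneg_forms_def positive_forms_def intro!: exI[of _ h])
next
  fix g assume "g \<in> {g \<in> binary_forms d. \<exists>h. (\<forall>n. h n \<in> positive_forms d) \<and>
     (\<forall>i j. (\<lambda>n. coeff (coeff (h n) j) i) \<longlonglongrightarrow> coeff (coeff g j) i)}"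
  then obtain h where g: "g \<in> binary_forms d" and h: "\<And>n. h n \<in> positive_forms d"
    and lim: "\<And>i j. (\<lambda>n. coeff (coeff (h n) j) i) \<longlonglongrightarrow> coeff (coeff g j) i"
    by auto
  have hb: "h n \<in> binary_forms d" for n
    using h by (simp add: positive_forms_def)
  have L: "(\<lambda>n. eval2 (h n) (x, y)) \<longlonglongrightarrow> eval2 g (x, y)" for x y
    unfolding eval2_binary_form[OF g] eval2_binary_form[OF hb]
    by (intro tendsto_intros lim)
  have "eval2 g (x, y) \<ge> 0" if "(x, y) \<noteq> (0, 0)" for x y
    using h that by (intro LIMSEQ_le_const[OF L]) (auto simp: positive_forms_def less_imp_le)
  moreover have "eval2 g (0, 0) \<ge> 0"
  proof (cases "d = 0")
    case False
    have "eval2 g (0, 0) = 0"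
      unfolding eval2_binary_form[OF g] using False
      by (intro sum.neutral ballI) (auto simp: power_0_left)
    thus ?thesis by simp
  next
    case True
    have "eval2 g (0, 0) = eval2 g (1, 0)"
      by (simp add: eval2_binary_form[OF g] True)
    thus ?thesis using calculation[of 1 0] by simp
  qed
  ultimately have "eval2 g (x, y) \<ge> 0" for x y
    by (cases "(x, y) = (0, 0)") simp_all
  thus "g \<in> nonneg_forms d"
    using g by (simp add: nonneg_forms_def)
qed

end

theory Submission
  imports Defs
begin

text \<open>
  Write \<open>d = 2 * Suc n\<close>. On the cone around a direction \<open>(1, t)\<close> homogeneity gives
  \<open>g (x, y) = x ^ d * g (1, y / x)\<close>. If \<open>(1, t)\<close> is a zero of order at most \<open>n\<close>, then
  \<open>g (1, s) \<ge> c * \<bar>s - t\<bar> ^ n\<close> near \<open>t\<close>, so the part of the sublevel set with \<open>\<bar>x\<bar> \<ge> 1\<close> lies in a band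
  around the line of width \<open>C * \<bar>x\<bar> powr - a\<close> with \<open>a > 1\<close>, which has finite area by Fubini.
  Finitely many such cones, together with one around \<open>(0, 1)\<close>, cover the plane. If the order is at
  least \<open>n + 1\<close>, the sublevel set contains a band of width proportional to \<open>1 / x\<close>, of infinite area.
  For \<open>d = 4\<close>, a zero of a non-negative form has order at least 2, so none is allowed; and a form with
  a negative value has a sublevel set containing arbitrarily large discs.
\<close>

subsection \<open>Areas of bands around lines\<close>

text \<open>Serves the vertical direction, which has no slope: exchanging the coordinates turns it
  into the direction of slope 0.\<close>

lemma emeasure_lborel_swap:
  fixes A :: "(real \<times> real) set"
  assumes "A \<in> sets borel"
  shows "emeasure lborel (prod.swap -` A) = emeasure lborel A"
proof -
  have "lborel = distr lborel lborel (\<lambda>(x::real, y::real). (y, x))"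
    using lborel_pair.distr_pair_swap unfolding lborel_prod .
  hence "emeasure lborel A = emeasure (distr lborel lborel (\<lambda>(x::real, y::real). (y, x))) A"
    by simp
  also have "\<dots> = emeasure lborel ((\<lambda>(x, y). (y, x)) -` A)"
    using assms by (subst emeasure_distr) (auto simp: borel_prod[symmetric] space_pair_measure)
  also have "(\<lambda>(x, y). (y, x)) -` A = prod.swap -` A"
    by auto
  finally show ?thesis by simp
qed

text \<open>By Fubini: the slice over \<open>x \<in> X\<close> is an interval of length
  \<open>2 * f x\<close> centred at \<open>t * x\<close>, so the slope does not enter the
  area.\<close>

lemma emeasure_band:
  fixes f :: "real \<Rightarrow> real"
  assumes [measurable]: "X \<in> sets borel" "f \<in> borel_measurable borel" and "\<And>x. x \<in> X \<Longrightarrow> 0 \<le> f x"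
  shows "emeasure lborel {(x, y). x \<in> X \<and> \<bar>y - t * x\<bar> \<le> f x} =
    (\<integral>\<^sup>+x. ennreal (2 * f x) * indicator X x \<partial>lborel)"
proof -
  let ?A = "{(x, y). x \<in> X \<and> \<bar>y - t * x\<bar> \<le> f x}"
  have "Measurable.pred (borel \<Otimes>\<^sub>M borel) (\<lambda>z. fst z \<in> X \<and> \<bar>snd z - t * fst z\<bar> \<le> f (fst z))"
    by measurable
  hence "?A \<in> sets (borel \<Otimes>\<^sub>M borel)"
    by (simp add: pred_def space_pair_measure case_prod_unfold)
  hence "emeasure lborel ?A = (\<integral>\<^sup>+x. emeasure lborel (Pair x -` ?A) \<partial>lborel)"
    unfolding lborel_prod[symmetric] by (intro lborel.emeasure_pair_measure_alt) simp
  also have "\<dots> = (\<integral>\<^sup>+x. ennreal (2 * f x) * indicator X x \<partial>lborel)"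
  proof (intro nn_integral_cong)
    fix x
    show "emeasure lborel (Pair x -` ?A) = ennreal (2 * f x) * indicator X x"
    proof (cases "x \<in> X")
      case True
      hence "Pair x -` ?A = {t * x - f x..t * x + f x}"
        by (auto simp: abs_le_iff)
      thus ?thesis using True assms(3)[OF True] by simp
    qed auto
  qed
  finally show ?thesis .
qed

lemma emeasure_lborel_uminus:
  fixes A :: "'a::euclidean_space set"
  assumes "A \<in> sets borel"
  shows "emeasure lborel (uminus -` A) = emeasure lborel A"
proof -
  \<comment> \<open>Negation is the affine map with factor -1 and shift 0; its Jacobian has absolute
    value 1, so the resulting density is constantly 1.\<close>
  have "distr lborel borel uminus = (lborel :: 'a measure)"
    by (subst lborel_affine[of "-1" 0]) (auto simp: density_1 one_ennreal_def[symmetric])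
  hence "emeasure lborel A = emeasure (distr lborel borel uminus) A"
    by simp
  also have "\<dots> = emeasure lborel (uminus -` A)"
    using assms by (subst emeasure_distr) auto
  finally show ?thesis by simp
qed

text \<open>The tail integral of \<open>x powr - a\<close> converges for \<open>a > 1\<close>. The
  half with \<open>x \<le> -1\<close> is the preimage of the other half under negation.\<close>

lemma band_fmeasurable:
  fixes a t C :: real
  assumes "a > 1" "C \<ge> 0"
  shows "{(x, y). 1 \<le> \<bar>x\<bar> \<and> \<bar>y - t * x\<bar> \<le> C * \<bar>x\<bar> powr - a} \<in> fmeasurable lborel"
proof -
  let ?B = "{(x, y). x \<in> {1..} \<and> \<bar>y - t * x\<bar> \<le> C * x powr - a}"
  have "Measurable.pred (borel \<Otimes>\<^sub>M borel)
      (\<lambda>z. 1 \<le> fst z \<and> \<bar>snd z - t * fst z\<bar> \<le> C * fst z powr - a)"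
    by measurable
  hence sets: "?B \<in> sets borel"
    by (simp add: pred_def space_pair_measure case_prod_unfold borel_prod)
  \<comment> \<open>An antiderivative of \<open>2 * (C * x powr - a)\<close> that tends to 0 at
    infinity because \<open>1 - a < 0\<close>; the integral is therefore
    \<open>0 - F 1\<close>.\<close>
  define F where "F x = 2 * C / (1 - a) * x powr (1 - a)" for x
  have "emeasure lborel ?B =
      (\<integral>\<^sup>+x. ennreal (2 * (C * x powr - a)) * indicator {1..} x \<partial>lborel)"
    using assms by (intro emeasure_band) auto
  also have "\<dots> = ennreal (0 - F 1)"
  proof (rule nn_integral_FTC_atLeast)
    fix x :: real
    assume x: "1 \<le> x"
    have "((\<lambda>x. x powr (1 - a)) has_real_derivative (1 - a) * x powr (1 - a - 1)) (at x)"
      using x by (intro has_real_derivative_powr) auto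
    from DERIV_cmult[OF this, of "2 * C / (1 - a)"]
    show "(F has_real_derivative 2 * (C * x powr - a)) (at x)"
      unfolding F_def using assms by simp
  next
    have "((\<lambda>x::real. x powr (1 - a)) \<longlongrightarrow> 0) at_top"
      using assms tendsto_neg_powr[of "1 - a" "\<lambda>x::real. x" at_top]
      by (simp add: filterlim_ident)
    from tendsto_mult_left[OF this, of "2 * C / (1 - a)"]
    show "(F \<longlongrightarrow> 0) at_top" by (simp add: F_def[abs_def])
  qed (use assms in auto)
  finally have B: "?B \<in> fmeasurable lborel"
    using sets by (intro fmeasurableI) auto
  have "uminus -` ?B \<in> sets borel"
    using measurable_sets[OF borel_measurable_uminus[OF measurable_ident] sets] by simp
  hence "uminus -` ?B \<in> fmeasurable lborel"
    unfolding fmeasurable_def using B emeasure_lborel_uminus[OF sets]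
    by (simp add: fmeasurable_def del: vimage_Collect_eq)
  with B have "?B \<union> uminus -` ?B \<in> fmeasurable lborel"
    by (rule fmeasurable.Un)
  also have "?B \<union> uminus -` ?B = {(x, y). 1 \<le> \<bar>x\<bar> \<and> \<bar>y - t * x\<bar> \<le> C * \<bar>x\<bar> powr - a}"
    by (auto simp: abs_if split: if_splits)
  finally show ?thesis .
qed

text \<open>The integral of \<open>1 / x\<close> diverges logarithmically: the part up to
  \<open>b\<close> already contributes \<open>2 * C * ln b\<close>.\<close>

lemma emeasure_hyperbolic_band:
  fixes t C :: real
  assumes "C > 0"
  shows "emeasure lborel {(x, y). 1 \<le> x \<and> \<bar>y - t * x\<bar> \<le> C / x} = \<infinity>"
proof -
  let ?I = "\<integral>\<^sup>+x. ennreal (2 * (C / x)) * indicator {1..} x \<partial>lborel"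
  have le: "ennreal (2 * C * ln b) \<le> ?I" if "b \<ge> 1" for b
  proof -
    have "(\<integral>\<^sup>+x. ennreal (2 * (C / x)) * indicator {1..b} x \<partial>lborel)
        = ennreal (2 * C * ln b - 2 * C * ln 1)"
      using that assms
      by (intro nn_integral_FTC_Icc) (auto intro!: derivative_eq_intros)
    moreover have "(\<integral>\<^sup>+x. ennreal (2 * (C / x)) * indicator {1..b} x \<partial>lborel) \<le> ?I"
      by (intro nn_integral_mono) (auto simp: indicator_def)
    ultimately show ?thesis by simp
  qed
  \<comment> \<open>The choice \<open>b = exp (r / (2 * C))\<close> makes
    \<open>2 * C * ln b\<close> equal to \<open>r\<close>; a finite \<open>?I\<close> would then be
    at least \<open>?I + 1\<close>.\<close>
  have "ennreal r \<le> ?I" if "r \<ge> 0" for r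
    using le[of "exp (r / (2 * C))"] that assms by simp
  from this[of "enn2real ?I + 1"] have "?I = \<infinity>"
    by (cases ?I) auto
  moreover have "emeasure lborel {(x, y). x \<in> {1..} \<and> \<bar>y - t * x\<bar> \<le> C / x} = ?I"
    using assms by (intro emeasure_band) auto
  ultimately show ?thesis by simp
qed

subsection \<open>Lower bounds near a root, and sublevel sets in a cone\<close>

text \<open>Write \<open>p\<close> as \<open>(t - a) ^ k * q\<close> with \<open>k \<le> n\<close>
  and \<open>q\<close> nonzero at \<open>a\<close>. By continuity \<open>\<bar>q\<bar>\<close> stays
  above half its value at \<open>a\<close>, and \<open>\<delta> \<le> 1\<close> allows the exponent
  \<open>k\<close> to be raised to \<open>n\<close>.\<close>

lemma poly_lower_bound:
  fixes p :: "real poly"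
  assumes "\<not> [:- a, 1:] ^ Suc n dvd p"
  obtains c \<delta> where "c > 0" "0 < \<delta>" "\<delta> \<le> 1"
    "\<And>t. \<bar>t - a\<bar> < \<delta> \<Longrightarrow> c * \<bar>t - a\<bar> ^ n \<le> \<bar>poly p t\<bar>"
proof -
  have "p \<noteq> 0" and k: "order a p \<le> n"
    using assms unfolding order_divides by auto
  then obtain q where q: "p = [:- a, 1:] ^ order a p * q" and "\<not> [:- a, 1:] dvd q"
    using order_decomp by blast
  hence qa: "poly q a \<noteq> 0"
    by (simp add: poly_eq_0_iff_dvd)
  have "isCont (poly q) a" by simp
  then obtain \<delta> where \<delta>: "\<delta> > 0"
      and near: "\<And>t. \<bar>t - a\<bar> < \<delta> \<Longrightarrow> \<bar>poly q t - poly q a\<bar> < \<bar>poly q a\<bar> / 2"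
    using qa unfolding continuous_at_eps_delta dist_real_def
    by (metis half_gt_zero zero_less_abs_iff)
  show ?thesis
  proof
    show "\<bar>poly q a\<bar> / 2 > 0" "0 < min \<delta> 1" "min \<delta> 1 \<le> 1"
      using qa \<delta> by auto
    fix t assume t: "\<bar>t - a\<bar> < min \<delta> 1"
    have "\<bar>poly q a\<bar> / 2 \<le> \<bar>poly q t\<bar>"
      using near[of t] t by linarith
    moreover have "\<bar>t - a\<bar> ^ n \<le> \<bar>t - a\<bar> ^ order a p"
      using k t by (intro power_decreasing) auto
    ultimately have "\<bar>poly q a\<bar> / 2 * \<bar>t - a\<bar> ^ n \<le> \<bar>poly q t\<bar> * \<bar>t - a\<bar> ^ order a p"
      by (intro mult_mono) auto
    also have "\<dots> = \<bar>poly p t\<bar>"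
      by (subst q) (simp add: abs_mult power_abs)
    finally show "\<bar>poly q a\<bar> / 2 * \<bar>t - a\<bar> ^ n \<le> \<bar>poly p t\<bar>" .
  qed
qed

text \<open>A root of a non-negative polynomial is a minimum, so the derivative vanishes there too;
  by the product rule the cofactor of the first linear factor then has the same root.\<close>

lemma square_dvd_nonneg_poly:
  fixes p :: "real poly"
  assumes "\<And>t. poly p t \<ge> 0" and "poly p a = 0"
  shows "[:- a, 1:] ^ 2 dvd p"
proof -
  obtain q where q: "p = [:- a, 1:] * q"
    using assms(2) by (auto simp: poly_eq_0_iff_dvd)
  have "poly (pderiv p) a = 0"
    using assms by (intro DERIV_local_min[OF poly_DERIV, of 1]) auto
  moreover have "pderiv p = [:- a, 1:] * pderiv q + q"
    unfolding q pderiv_mult by (simp add: pderiv_pCons)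
  ultimately have "[:- a, 1:] dvd q"
    by (simp add: poly_eq_0_iff_dvd[symmetric])
  thus ?thesis
    unfolding q power2_eq_square by (intro mult_dvd_mono) auto
qed

lemma abs_slope_diff:
  fixes x y t :: real
  assumes "x \<noteq> 0"
  shows "\<bar>y - t * x\<bar> = \<bar>y / x - t\<bar> * \<bar>x\<bar>"
  using assms by (simp add: abs_mult[symmetric] algebra_simps)

text \<open>For \<open>\<bar>x\<bar> > 1\<close> the lower bound forces the slope so close to
  \<open>t\<close> that the point lies in a band of finite area; the rest of the set lies in a box.
  An arbitrary \<open>f\<close> allows use with exchanged coordinates as well.\<close>

lemma sublevel_cone_fmeasurable:
  fixes f :: "real \<times> real \<Rightarrow> real"
  assumes [measurable]: "f \<in> borel_measurable borel"
    and "c > 0" "0 < \<delta>" "\<delta> \<le> 1"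
    and lower: "\<And>x y. x \<noteq> 0 \<Longrightarrow> \<bar>y / x - t\<bar> < \<delta> \<Longrightarrow>
      c * \<bar>x\<bar> ^ (2 * Suc n) * \<bar>y / x - t\<bar> ^ n \<le> f (x, y)"
  shows "{(x, y). f (x, y) \<le> 1 \<and> \<bar>y - t * x\<bar> < \<delta> * \<bar>x\<bar>} \<in> fmeasurable lborel"
proof -
  \<comment> \<open>Solving \<open>\<bar>x\<bar> ^ (4 * n + 4) * v ^ (2 * n + 1) \<le> 1 /
    c\<^sup>2\<close> for \<open>v\<close> gives \<open>C\<close> and the decay
    \<open>(4 * n + 4) / s\<close>; multiplying by \<open>\<bar>x\<bar>\<close> lowers this rate by
    1, to \<open>a\<close>.\<close>
  define s where "s = real (2 * n + 1)"
  define C where "C = (1 / c\<^sup>2) powr (1 / s)"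
  define a where "a = (2 * real n + 3) / s"
  let ?A = "{(x, y). f (x, y) \<le> 1 \<and> \<bar>y - t * x\<bar> < \<delta> * \<bar>x\<bar>}"
  let ?B = "{(x, y). 1 \<le> \<bar>x\<bar> \<and> \<bar>y - t * x\<bar> \<le> C * \<bar>x\<bar> powr - a}"
  let ?Q = "cbox (- 1, - (\<bar>t\<bar> + 1)) (1, \<bar>t\<bar> + 1) :: (real \<times> real) set"
  have s: "s > 0" and a: "a > 1"
    by (auto simp: s_def a_def field_simps)
  have "?A \<subseteq> ?Q \<union> ?B"
  proof (rule subsetI, rule UnCI)
    fix z assume "z \<in> ?A" "z \<notin> ?B"
    then obtain x y where z: "z = (x, y)" and f: "f (x, y) \<le> 1"
        and cone: "\<bar>y - t * x\<bar> < \<delta> * \<bar>x\<bar>" and B: "(x, y) \<notin> ?B"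
      by blast
    have x: "x \<noteq> 0" using cone by auto
    define v where "v = \<bar>y / x - t\<bar>"
    have yv: "\<bar>y - t * x\<bar> = v * \<bar>x\<bar>"
      unfolding v_def by (rule abs_slope_diff[OF x])
    have v: "0 \<le> v" "v < \<delta>"
      using cone x unfolding yv by (auto simp: v_def)
    have "\<not> 1 < \<bar>x\<bar>"
    proof
      assume x1: "1 < \<bar>x\<bar>"
      have "c * \<bar>x\<bar> ^ (2 * Suc n) * v ^ n \<le> 1"
        using lower[OF x, of y] v f unfolding v_def[symmetric] by linarith
      txt \<open>Squaring turns the bound on \<open>v ^ n\<close> into one on \<open>v ^ (2 * n + 1)\<close>, whose exponent is
        positive even for \<open>n = 0\<close> and still small enough to give a decay rate \<open>a > 1\<close>.\<close>
      hence "(c * \<bar>x\<bar> ^ (2 * Suc n) * v ^ n)\<^sup>2 \<le> 1"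
        using assms v by (intro power_le_one) auto
      moreover have "(c * \<bar>x\<bar> ^ (2 * Suc n) * v ^ n)\<^sup>2 =
          c\<^sup>2 * (\<bar>x\<bar> ^ (2 * Suc n * 2) * v ^ (n * 2))"
        unfolding power_mult_distrib power_mult by (simp only: mult.assoc)
      moreover have "2 * Suc n * 2 = 4 * n + 4" "n * 2 = 2 * n"
        by auto
      ultimately have "c\<^sup>2 * (\<bar>x\<bar> ^ (4 * n + 4) * v ^ (2 * n)) \<le> 1"
        by metis
      hence 1: "\<bar>x\<bar> ^ (4 * n + 4) * v ^ (2 * n) \<le> 1 / c\<^sup>2"
        using \<open>c > 0\<close> by (subst pos_le_divide_eq) (auto simp: mult.commute)
      have "v ^ (2 * n + 1) \<le> v ^ (2 * n)"
        using v assms by (intro power_decreasing) auto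
      hence "\<bar>x\<bar> ^ (4 * n + 4) * v ^ (2 * n + 1) \<le> 1 / c\<^sup>2"
        by (intro order.trans[OF mult_left_mono 1]) auto
      hence 2: "v ^ (2 * n + 1) \<le> 1 / c\<^sup>2 / \<bar>x\<bar> ^ (4 * n + 4)"
        using x by (subst pos_le_divide_eq) (auto simp: mult.commute)
      \<comment> \<open>The case \<open>v = 0\<close> is separate because rewriting a power as
        \<open>powr\<close> requires a positive base.\<close>
      have "v = (v ^ (2 * n + 1)) powr (1 / s)"
      proof (cases "v = 0")
        case False
        hence "v ^ (2 * n + 1) = v powr s"
          using v unfolding s_def by (intro powr_realpow[symmetric]) auto
        thus ?thesis using v s by (simp add: powr_powr)
      qed (use s in auto)
      also have "\<dots> \<le> (1 / c\<^sup>2 / \<bar>x\<bar> ^ (4 * n + 4)) powr (1 / s)"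
        using 2 s v by (intro powr_mono2) auto
      also have "\<bar>x\<bar> ^ (4 * n + 4) = \<bar>x\<bar> powr (4 * real n + 4)"
        using x by (subst powr_realpow[symmetric]) auto
      also have "(1 / c\<^sup>2 / \<bar>x\<bar> powr (4 * real n + 4)) powr (1 / s)
          = C * \<bar>x\<bar> powr (- ((4 * real n + 4) / s))"
        using x s by (simp add: C_def powr_divide powr_powr powr_minus_divide powr_mult)
      finally have "v * \<bar>x\<bar> \<le> C * \<bar>x\<bar> powr (- ((4 * real n + 4) / s)) * \<bar>x\<bar>"
        using x by (simp add: mult_right_mono)
      also have "\<dots> = C * (\<bar>x\<bar> powr (- ((4 * real n + 4) / s)) * \<bar>x\<bar> powr 1)"
        using x by simp
      also have "\<dots> = C * \<bar>x\<bar> powr (1 - (4 * real n + 4) / s)"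
        by (subst powr_add[symmetric]) simp
      also have "1 - (4 * real n + 4) / s = (s - (4 * real n + 4)) / s"
        using s by (simp add: diff_divide_distrib)
      also have "s - (4 * real n + 4) = - (2 * real n + 3)"
        by (simp add: s_def)
      also have "- (2 * real n + 3) / s = - a"
        unfolding a_def by (rule minus_divide_left[symmetric])
      finally show False using B x1 yv by auto
    qed
    \<comment> \<open>Here \<open>\<bar>x\<bar> \<le> 1\<close> and
      \<open>v < \<delta> \<le> 1\<close>; adding
      \<open>\<bar>t * x\<bar> \<le> \<bar>t\<bar>\<close> gives the height
      \<open>\<bar>t\<bar> + 1\<close> of the box.\<close>
    moreover have "\<bar>y - t * x\<bar> \<le> 1"
      using calculation v assms unfolding yv by (intro mult_le_one) auto
    moreover have "\<bar>t * x\<bar> \<le> \<bar>t\<bar>"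
      using calculation by (simp add: abs_mult mult_left_le)
    ultimately show "z \<in> ?Q"
      unfolding z by (auto simp: cbox_Pair_eq abs_le_iff)
  qed
  moreover have "?Q \<union> ?B \<in> fmeasurable lborel"
    using band_fmeasurable[OF a, of C] by (intro fmeasurable.Un fmeasurable_cbox) (auto simp: C_def)
  moreover have "?A \<in> sets lborel"
  proof -
    have [measurable]: "f \<in> borel_measurable (borel \<Otimes>\<^sub>M borel)"
      by (simp add: borel_prod)
    have "Measurable.pred (borel \<Otimes>\<^sub>M borel)
        (\<lambda>z. f z \<le> 1 \<and> \<bar>snd z - t * fst z\<bar> < \<delta> * \<bar>fst z\<bar>)"
      by measurable
    thus ?thesis
      by (simp add: pred_def space_pair_measure case_prod_unfold borel_prod)
  qed
  ultimately show ?thesis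
    using fmeasurableI2 by blast
qed

subsection \<open>Binary forms and their linear factors\<close>

lemma eval2_mult: "eval2 (p * q) z = eval2 p z * eval2 q z"
  by (simp add: eval2_def)

lemma eval2_power: "eval2 (p ^ k) z = eval2 p z ^ k"
  by (simp add: eval2_def)

lemma eval2_eq_sum: "eval2 p z = (\<Sum>j\<le>degree p. poly (coeff p j) (fst z) * snd z ^ j)"
  by (simp add: eval2_def poly_altdef[of p] poly_sum)

lemma continuous_on_eval2 [continuous_intros]:
  assumes "continuous_on S f"
  shows "continuous_on S (\<lambda>x. eval2 p (f x))"
  unfolding eval2_eq_sum by (intro continuous_intros assms)

lemma eval2_borel_measurable [measurable]: "eval2 p \<in> borel_measurable borel"
  by (intro borel_measurable_continuous_onI continuous_on_eval2 continuous_on_id)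

lemma eval2_scale:
  assumes "g \<in> binary_forms d"
  shows "eval2 g (c * x, c * y) = c ^ d * eval2 g (x, y)"
  unfolding eval2_binary_form[OF assms] sum_distrib_left
proof (rule sum.cong)
  fix j assume "j \<in> {..d}"
  hence "c ^ d = c ^ (d - j) * c ^ j"
    by (simp flip: power_add)
  thus "coeff (coeff g j) (d - j) * (c * x) ^ (d - j) * (c * y) ^ j =
      c ^ d * (coeff (coeff g j) (d - j) * x ^ (d - j) * y ^ j)"
    by (simp add: power_mult_distrib)
qed simp

section \<open>Passage between binary forms and polynomials in one variable\<close>

text \<open>This is \<open>x\<^sub>1 ^ n * q (x\<^sub>2 / x\<^sub>1)\<close> when
  \<open>degree q \<le> n\<close>; terms of higher degree are cut off.\<close>

definition homogenize :: "nat \<Rightarrow> real poly \<Rightarrow> real poly poly" where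
  "homogenize n q = (\<Sum>j\<le>n. monom (monom (coeff q j) (n - j)) j)"

lemma coeff_homogenize:
  "coeff (coeff (homogenize n q) j) i = (if i + j = n then coeff q j else 0)"
proof -
  have "coeff (homogenize n q) j = (if j \<le> n then monom (coeff q j) (n - j) else 0)"
    by (simp add: homogenize_def coeff_sum)
  thus ?thesis by auto
qed

text \<open>The degree bound prevents a loss by truncation: at \<open>i = 0\<close>,
  \<open>j = Suc n\<close> the left side contains \<open>- t * coeff q (Suc n)\<close>, which has no
  counterpart on the right.\<close>

lemma homogenize_linear_mult:
  assumes "degree q \<le> n"
  shows "homogenize (Suc n) ([:- t, 1:] * q) = [:[:0, - t:], 1:] * homogenize n q"
proof (intro poly_eqI)
  fix i j
  show "coeff (coeff (homogenize (Suc n) ([:- t, 1:] * q)) j) i =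
      coeff (coeff ([:[:0, - t:], 1:] * homogenize n q) j) i"
    using assms by (cases i; cases j) (auto simp: coeff_homogenize coeff_eq_0)
qed

lemma homogenize_linear_power_mult:
  assumes "degree q \<le> n"
  shows "homogenize (n + k) ([:- t, 1:] ^ k * q) = [:[:0, - t:], 1:] ^ k * homogenize n q"
proof (induction k)
  case (Suc k)
  have "degree ([:- t, 1:] ^ k * q) \<le> n + k"
    using degree_mult_le[of "[:- t, 1:] ^ k" q] assms by (simp add: degree_linear_power)
  from homogenize_linear_mult[OF this, of t] Suc show ?case
    by (simp only: power_Suc mult.assoc add_Suc_right)
qed simp

text \<open>For a form of degree \<open>d\<close> this is its restriction to
  \<open>x\<^sub>1 = 1\<close>, as a polynomial in the slope.\<close>

definition dehomogenize :: "nat \<Rightarrow> real poly poly \<Rightarrow> real poly" where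
  "dehomogenize d g = (\<Sum>j\<le>d. monom (coeff (coeff g j) (d - j)) j)"

lemma coeff_dehomogenize:
  "coeff (dehomogenize d g) j = (if j \<le> d then coeff (coeff g j) (d - j) else 0)"
  by (simp add: dehomogenize_def coeff_sum)

lemma homogenize_dehomogenize:
  assumes "g \<in> binary_forms d"
  shows "homogenize d (dehomogenize d g) = g"
  using assms by (intro poly_eqI) (auto simp: coeff_homogenize coeff_dehomogenize binary_forms_def)

lemma poly_dehomogenize:
  assumes "g \<in> binary_forms d"
  shows "poly (dehomogenize d g) t = eval2 g (1, t)"
  by (simp add: eval2_binary_form[OF assms] dehomogenize_def poly_sum poly_monom)

section \<open>Divisibility by powers of linear forms\<close>

text \<open>Homogenizing a factorization of the restriction factors \<open>g\<close> itself, and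
  \<open>line_form (a, b)\<close> is the unit \<open>- a\<close> times
  \<open>x\<^sub>2 - (b / a) * x\<^sub>1\<close>.\<close>

lemma line_form_power_dvd:
  assumes g: "g \<in> binary_forms d" and "a \<noteq> 0"
    and "[:- (b / a), 1:] ^ k dvd dehomogenize d g"
  shows "line_form (a, b) ^ k dvd g"
proof -
  obtain q where q: "dehomogenize d g = [:- (b / a), 1:] ^ k * q"
    using assms(3) by (auto elim: dvdE)
  have "degree (dehomogenize d g) \<le> d"
    by (intro degree_le) (simp add: coeff_dehomogenize)
  hence "[:[:0, - (b / a):], 1:] ^ k dvd g"
  proof (cases "q = 0")
    case True
    hence "g = 0"
      using homogenize_dehomogenize[OF g] q by (simp add: homogenize_def)
    thus ?thesis by simp
  next
    case False
    \<comment> \<open>This makes \<open>d - k\<close> a genuine difference and a bound for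
      \<open>degree q\<close>; additivity of degrees is the reason for excluding
      \<open>q = 0\<close>.\<close>
    hence "degree q + k \<le> d"
      using \<open>degree (dehomogenize d g) \<le> d\<close> unfolding q
      by (subst (asm) degree_mult_eq) (auto simp: degree_linear_power)
    hence "homogenize d (dehomogenize d g) = [:[:0, - (b / a):], 1:] ^ k * homogenize (d - k) q"
      using homogenize_linear_power_mult[of q "d - k" k "b / a"] unfolding q by simp
    thus ?thesis
      unfolding homogenize_dehomogenize[OF g] by simp
  qed
  moreover have "line_form (a, b) = [:[:- a:]:] * [:[:0, - (b / a):], 1:]"
    using \<open>a \<noteq> 0\<close> by (simp add: line_form_def)
  moreover have "[:[:- a:]:] ^ k dvd 1"
    using \<open>a \<noteq> 0\<close> by (simp add: is_unit_power_iff is_unit_const_poly_iff dvd_field_iff)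
  ultimately show ?thesis
    by (simp only: power_mult_distrib mult_unit_dvd_iff')
qed

text \<open>The restriction to \<open>x\<^sub>2 = 1\<close> is \<open>poly g 1\<close>. By
  homogeneity each power of \<open>x\<^sub>1\<close> occurs in at most one coefficient of
  \<open>g\<close>, so nothing cancels in this sum and its low coefficients vanish only if those of
  \<open>g\<close> do.\<close>

lemma line_form_infinity_power_dvd:
  assumes g: "g \<in> binary_forms d" and "b \<noteq> 0" and "[:0, 1:] ^ k dvd poly g 1"
  shows "line_form (0, b) ^ k dvd g"
proof -
  have "monom 1 k dvd coeff g j" for j
    unfolding monom_1_dvd_iff'
  proof (intro allI impI)
    fix i assume "i < k"
    have eq: "j' = j" if "coeff (coeff g j) i \<noteq> 0" "coeff (coeff g j') i \<noteq> 0" for j'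
    proof -
      have "i + j = d" "i + j' = d"
        using g that unfolding binary_forms_def by blast+
      thus ?thesis by simp
    qed
    have "monom 1 k dvd poly g 1"
      using assms(3) by (simp add: monom_altdef)
    hence "coeff (poly g 1) i = 0"
      using \<open>i < k\<close> by (simp only: monom_1_dvd_iff')
    hence "(\<Sum>j\<le>degree g. coeff (coeff g j) i) = 0"
      by (simp add: poly_altdef coeff_sum)
    moreover have "(\<Sum>j'\<le>degree g. coeff (coeff g j') i) = coeff (coeff g j) i"
      if nz: "coeff (coeff g j) i \<noteq> 0"
    proof -
      have "coeff g j \<noteq> 0" using nz by auto
      hence "j \<le> degree g" by (rule le_degree)
      hence "(\<Sum>j'\<le>degree g. coeff (coeff g j') i) = (\<Sum>j'\<in>{j}. coeff (coeff g j') i)"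
        using eq[OF nz] by (intro sum.mono_neutral_right) auto
      thus ?thesis by simp
    qed
    ultimately show "coeff (coeff g j) i = 0" by auto
  qed
  hence "[:monom (b ^ k) k:] dvd g"
    unfolding const_poly_dvd_iff using smult_dvd[of "monom 1 k" _ "b ^ k"] \<open>b \<noteq> 0\<close>
    by (simp add: smult_monom)
  moreover have "line_form (0, b) = [:monom b 1:]"
    by (simp add: line_form_def monom_Suc monom_0)
  ultimately show ?thesis
    by (simp add: poly_const_pow monom_power)
qed

text \<open>On the line \<open>x\<^sub>1 = 1\<close>, or \<open>x\<^sub>2 = 1\<close> if
  \<open>a = 0\<close>, the form is a non-negative polynomial, whose roots are at least
  double.\<close>

lemma square_line_form_dvd:
  assumes g: "g \<in> nonneg_forms d" and z: "z \<noteq> (0, 0)" "eval2 g z = 0"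
  shows "line_form z ^ 2 dvd g"
proof -
  obtain a b where ab: "z = (a, b)" by (cases z)
  have gb: "g \<in> binary_forms d" and nn: "\<And>z. eval2 g z \<ge> 0"
    using g by (auto simp: nonneg_forms_def)
  show ?thesis
  proof (cases "a = 0")
    case False
    have "eval2 g (a * 1, a * (b / a)) = 0"
      using z ab False by simp
    hence "eval2 g (1, b / a) = 0"
      unfolding eval2_scale[OF gb] using False by simp
    hence "[:- (b / a), 1:] ^ 2 dvd dehomogenize d g"
      by (intro square_dvd_nonneg_poly) (auto simp: poly_dehomogenize[OF gb] nn)
    thus ?thesis
      unfolding ab by (rule line_form_power_dvd[OF gb False])
  next
    case True
    hence "b \<noteq> 0" using z ab by auto
    have "eval2 g (b * 0, b * 1) = 0"
      using z ab True by simp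
    hence "eval2 g (0, 1) = 0"
      unfolding eval2_scale[OF gb] using \<open>b \<noteq> 0\<close> by simp
    hence "[:- 0, 1:] ^ 2 dvd poly g 1"
      using nn[of "(_, 1)"] by (intro square_dvd_nonneg_poly) (auto simp: eval2_def one_pCons)
    hence "[:0, 1:] ^ 2 dvd poly g 1" by simp
    thus ?thesis
      unfolding ab True by (rule line_form_infinity_power_dvd[OF gb \<open>b \<noteq> 0\<close>])
  qed
qed

text \<open>Exponents of dividing powers are closed downwards, so the single exponent
  \<open>Suc n\<close> decides the bound. This covers the zero form, where every power
  divides.\<close>

lemma zero_order_le_iff: "zero_order g z \<le> enat n \<longleftrightarrow> \<not> line_form z ^ Suc n dvd g"
proof
  assume le: "zero_order g z \<le> enat n"
  show "\<not> line_form z ^ Suc n dvd g"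
  proof
    assume "line_form z ^ Suc n dvd g"
    hence "enat (Suc n) \<le> zero_order g z"
      unfolding zero_order_def by (intro Sup_upper) blast
    hence "enat (Suc n) \<le> enat n" using le by (rule order.trans)
    thus False by simp
  qed
next
  assume ndvd: "\<not> line_form z ^ Suc n dvd g"
  have "k \<le> n" if "line_form z ^ k dvd g" for k
  proof (rule ccontr)
    assume "\<not> k \<le> n"
    hence "line_form z ^ Suc n dvd g"
      by (intro power_le_dvd[OF that]) simp
    thus False using ndvd by contradiction
  qed
  thus "zero_order g z \<le> enat n"
    unfolding zero_order_def by (intro Sup_least) auto
qed

subsection \<open>Volumes of sublevel sets of forms\<close>

lemma fmeasurable_swap:
  fixes A :: "(real \<times> real) set"
  assumes "A \<in> fmeasurable lborel"
  shows "prod.swap -` A \<in> fmeasurable lborel"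
proof (rule fmeasurableI)
  have A: "A \<in> sets borel" using assms by (simp add: fmeasurable_def)
  have "prod.swap \<in> borel_measurable (borel :: (real \<times> real) measure)"
    by (intro borel_measurable_continuous_onI continuous_on_swap)
  from measurable_sets[OF this A] show "prod.swap -` A \<in> sets lborel" by simp
  show "emeasure lborel (prod.swap -` A) < \<infinity>"
    using assms unfolding emeasure_lborel_swap[OF A] by (simp add: fmeasurable_def)
qed

text \<open>With \<open>v = \<bar>y / x - t\<bar>\<close> the upper bound is
  \<open>K * (x\<^sup>2 * v) ^ Suc n\<close>, as the degree is exactly twice \<open>Suc n\<close>;
  on a band of width proportional to \<open>1 / x\<close> the product \<open>x\<^sup>2 * v\<close>
  stays bounded.\<close>

lemma emeasure_sublevel_infinite:
  fixes f :: "real \<times> real \<Rightarrow> real"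
  assumes [measurable]: "f \<in> borel_measurable borel"
    and "K \<ge> 0"
    and upper: "\<And>x y. 1 \<le> x \<Longrightarrow> \<bar>y / x - t\<bar> \<le> 1 \<Longrightarrow>
      f (x, y) \<le> K * x ^ (2 * Suc n) * \<bar>y / x - t\<bar> ^ Suc n"
  shows "emeasure lborel {z. f z \<le> 1} = \<infinity>"
proof -
  \<comment> \<open>Adding 1 to \<open>K\<close> secures both \<open>\<epsilon> \<le> 1\<close> and
    \<open>K * \<epsilon> \<le> 1\<close>, also for \<open>K = 0\<close>.\<close>
  define \<epsilon> where "\<epsilon> = 1 / (K + 1)"
  have \<epsilon>: "0 < \<epsilon>" "\<epsilon> \<le> 1" "K * \<epsilon> \<le> 1"
    using \<open>K \<ge> 0\<close> by (auto simp: \<epsilon>_def)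
  have "{(x, y). 1 \<le> x \<and> \<bar>y - t * x\<bar> \<le> \<epsilon> / x} \<subseteq> {z. f z \<le> 1}"
  proof clarify
    fix x y assume x: "1 \<le> x" and y: "\<bar>y - t * x\<bar> \<le> \<epsilon> / x"
    define v where "v = \<bar>y / x - t\<bar>"
    have "\<bar>y - t * x\<bar> = v * x"
      using abs_slope_diff[of x y t] x by (simp add: v_def)
    hence v: "x\<^sup>2 * v \<le> \<epsilon>"
      using x y by (simp add: pos_le_divide_eq power2_eq_square mult_ac)
    have "1 * v \<le> x\<^sup>2 * v"
      using x by (intro mult_right_mono) (auto simp: v_def)
    hence v1: "v \<le> 1" using v \<epsilon> by linarith
    have "f (x, y) \<le> K * x ^ (2 * Suc n) * v ^ Suc n"
      using upper[OF x, of y] v1 by (simp add: v_def)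
    also have "x ^ (2 * Suc n) = (x\<^sup>2) ^ Suc n"
      by (rule power_mult)
    also have "K * (x\<^sup>2) ^ Suc n * v ^ Suc n = K * (x\<^sup>2 * v) ^ Suc n"
      by (simp only: power_mult_distrib mult.assoc)
    also have "\<dots> \<le> K * \<epsilon> ^ Suc n"
      using v \<open>K \<ge> 0\<close> by (intro mult_left_mono power_mono) (auto simp: v_def)
    also have "\<dots> \<le> K * \<epsilon> ^ 1"
      using \<epsilon> \<open>K \<ge> 0\<close> by (intro mult_left_mono power_decreasing) auto
    finally show "f (x, y) \<le> 1" using \<epsilon> by simp
  qed
  moreover have "{z. f z \<le> 1} \<in> sets lborel"
    by measurable
  ultimately have "emeasure lborel {(x, y). 1 \<le> x \<and> \<bar>y - t * x\<bar> \<le> \<epsilon> / x} \<le> emeasure lborel {z. f z \<le> 1}"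
    by (intro emeasure_mono)
  thus ?thesis
    unfolding emeasure_hyperbolic_band[OF \<epsilon>(1)] by (simp add: top_unique)
qed

lemma continuous_bounded_on_Icc:
  fixes h :: "real \<Rightarrow> real"
  assumes "continuous_on UNIV h"
  obtains C where "C \<ge> 0" "\<And>t. a \<le> t \<Longrightarrow> t \<le> b \<Longrightarrow> \<bar>h t\<bar> \<le> C"
proof -
  have "compact (h ` {a..b})"
    using assms by (intro compact_continuous_image) (auto intro: continuous_on_subset)
  hence "bounded (h ` {a..b})" by (rule compact_imp_bounded)
  then obtain C where "C > 0" "\<forall>x\<in>h ` {a..b}. norm x \<le> C"
    unfolding bounded_pos by blast
  thus ?thesis by (intro that[of C]) auto
qed

lemma infinite_volume_if_line_form_power_dvd:
  assumes g: "g \<in> binary_forms (2 * Suc n)" and z: "z \<noteq> (0, 0)"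
    and "line_form z ^ Suc n dvd g"
  shows "emeasure lborel {x. eval2 g x \<le> 1} = \<infinity>"
proof -
  obtain a b where ab: "z = (a, b)" by (cases z)
  obtain h where h: "g = line_form (a, b) ^ Suc n * h"
    using assms(3) ab by (auto elim: dvdE)
  have eval_g: "eval2 g (x, y) = (b * x - a * y) ^ Suc n * eval2 h (x, y)" for x y
    unfolding h eval2_mult eval2_power eval2_line_form ..
  show ?thesis
  proof (cases "a = 0")
    case False
    have "continuous_on UNIV (\<lambda>t. eval2 h (1, t))"
      by (intro continuous_intros)
    then obtain C where C: "C \<ge> 0"
        "\<And>t. b / a - 1 \<le> t \<Longrightarrow> t \<le> b / a + 1 \<Longrightarrow> \<bar>eval2 h (1, t)\<bar> \<le> C"
      using continuous_bounded_on_Icc by blast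
    show ?thesis
    proof (rule emeasure_sublevel_infinite)
      \<comment> \<open>In this constant \<open>\<bar>a\<bar> ^ Suc n\<close> comes from
        \<open>b - a * v = - a * (v - b / a)\<close>, and \<open>C\<close> bounds the cofactor
        \<open>h\<close> on slopes within 1 of \<open>b / a\<close>.\<close>
      show "0 \<le> \<bar>a\<bar> ^ Suc n * C" using C by simp
      fix x y :: real assume x: "1 \<le> x" and y: "\<bar>y / x - b / a\<bar> \<le> 1"
      define v where "v = y / x"
      have "eval2 g (x, y) = eval2 g (x * 1, x * v)"
        using x by (simp add: v_def)
      also have "\<dots> = x ^ (2 * Suc n) * eval2 g (1, v)"
        by (rule eval2_scale[OF g])
      also have "eval2 g (1, v) = (b - a * v) ^ Suc n * eval2 h (1, v)"
        unfolding eval_g by simp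
      also have "b - a * v = - a * (v - b / a)"
        using False by (simp add: algebra_simps)
      also have "(- a * (v - b / a)) ^ Suc n * eval2 h (1, v)
          \<le> \<bar>(- a * (v - b / a)) ^ Suc n\<bar> * \<bar>eval2 h (1, v)\<bar>"
        unfolding abs_mult[symmetric] by simp
      also have "\<bar>(- a * (v - b / a)) ^ Suc n\<bar> = \<bar>a\<bar> ^ Suc n * \<bar>v - b / a\<bar> ^ Suc n"
        by (simp only: power_abs abs_mult power_mult_distrib abs_minus_cancel)
      also have "\<dots> * \<bar>eval2 h (1, v)\<bar> \<le> \<bar>a\<bar> ^ Suc n * \<bar>v - b / a\<bar> ^ Suc n * C"
        using y by (intro mult_left_mono C) (auto simp: v_def)
      finally show "eval2 g (x, y) \<le> \<bar>a\<bar> ^ Suc n * C * x ^ (2 * Suc n) * \<bar>y / x - b / a\<bar> ^ Suc n"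
        using x by (simp add: v_def mult_left_mono mult_ac)
    qed simp
  next
    case True
    have "continuous_on UNIV (\<lambda>s. eval2 h (s, 1))"
      by (intro continuous_intros)
    then obtain C where C: "C \<ge> 0"
        "\<And>s. - 1 \<le> s \<Longrightarrow> s \<le> 1 \<Longrightarrow> \<bar>eval2 h (s, 1)\<bar> \<le> C"
      using continuous_bounded_on_Icc by blast
    \<comment> \<open>After the exchange of coordinates the zero line is the first axis, of slope
      0.\<close>
    have "emeasure lborel {x. eval2 g (prod.swap x) \<le> 1} = \<infinity>"
    proof (rule emeasure_sublevel_infinite)
      show "(\<lambda>x. eval2 g (prod.swap x)) \<in> borel_measurable borel"
        by (intro borel_measurable_continuous_onI continuous_intros continuous_on_swap)
      show "0 \<le> \<bar>b\<bar> ^ Suc n * C" using C by simp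
      fix x y :: real assume x: "1 \<le> x" and y: "\<bar>y / x - 0\<bar> \<le> 1"
      define v where "v = y / x"
      have "eval2 g (prod.swap (x, y)) = eval2 g (x * v, x * 1)"
        using x by (simp add: v_def)
      also have "\<dots> = x ^ (2 * Suc n) * eval2 g (v, 1)"
        by (rule eval2_scale[OF g])
      also have "eval2 g (v, 1) = (b * v) ^ Suc n * eval2 h (v, 1)"
        unfolding eval_g True by simp
      also have "(b * v) ^ Suc n * eval2 h (v, 1) \<le> \<bar>(b * v) ^ Suc n\<bar> * \<bar>eval2 h (v, 1)\<bar>"
        unfolding abs_mult[symmetric] by simp
      also have "\<bar>(b * v) ^ Suc n\<bar> = \<bar>b\<bar> ^ Suc n * \<bar>v\<bar> ^ Suc n"
        by (simp only: power_abs abs_mult power_mult_distrib)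
      also have "\<dots> * \<bar>eval2 h (v, 1)\<bar> \<le> \<bar>b\<bar> ^ Suc n * \<bar>v\<bar> ^ Suc n * C"
        using y by (intro mult_left_mono C) (auto simp: v_def abs_le_iff simp del: abs_divide)
      finally show "eval2 g (prod.swap (x, y)) \<le> \<bar>b\<bar> ^ Suc n * C * x ^ (2 * Suc n) * \<bar>y / x - 0\<bar> ^ Suc n"
        using x by (simp add: v_def mult_left_mono mult_ac)
    qed
    moreover have "{x. eval2 g (prod.swap x) \<le> 1} = prod.swap -` {x. eval2 g x \<le> 1}"
      by auto
    moreover have "{x. eval2 g x \<le> 1} \<in> sets borel" by measurable
    ultimately show ?thesis
      by (simp only: emeasure_lborel_swap)
  qed
qed

section \<open>Finite area from bounded orders of the zeros\<close>

lemma sublevel_sector_fmeasurable: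
  assumes g: "g \<in> binary_forms (2 * Suc n)" and nn: "\<And>z. eval2 g z \<ge> 0"
    and "\<not> line_form (1, t) ^ Suc n dvd g"
  obtains \<delta> where "\<delta> > 0" "{(x, y). eval2 g (x, y) \<le> 1 \<and> \<bar>y - t * x\<bar> < \<delta> * \<bar>x\<bar>} \<in> fmeasurable lborel"
proof -
  have "\<not> [:- t, 1:] ^ Suc n dvd dehomogenize (2 * Suc n) g"
    using line_form_power_dvd[OF g, of 1 t "Suc n"] assms(3) by auto
  then obtain c \<delta> where c: "c > 0" "0 < \<delta>" "\<delta> \<le> 1"
      "\<And>s. \<bar>s - t\<bar> < \<delta> \<Longrightarrow> c * \<bar>s - t\<bar> ^ n \<le> \<bar>poly (dehomogenize (2 * Suc n) g) s\<bar>"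
    using poly_lower_bound by blast
  have "{(x, y). eval2 g (x, y) \<le> 1 \<and> \<bar>y - t * x\<bar> < \<delta> * \<bar>x\<bar>} \<in> fmeasurable lborel"
  proof (rule sublevel_cone_fmeasurable[OF _ c(1-3)])
    fix x y :: real assume x: "x \<noteq> 0" and y: "\<bar>y / x - t\<bar> < \<delta>"
    have "c * \<bar>x\<bar> ^ (2 * Suc n) * \<bar>y / x - t\<bar> ^ n = x ^ (2 * Suc n) * (c * \<bar>y / x - t\<bar> ^ n)"
      by (simp add: power_even_abs)
    also have "\<dots> \<le> x ^ (2 * Suc n) * eval2 g (1, y / x)"
      using c(4)[OF y] nn[of "(1, y / x)"] unfolding poly_dehomogenize[OF g]
      by (intro mult_left_mono zero_le_even_power) auto
    also have "\<dots> = eval2 g (x * 1, x * (y / x))"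
      by (rule eval2_scale[OF g, symmetric])
    finally show "c * \<bar>x\<bar> ^ (2 * Suc n) * \<bar>y / x - t\<bar> ^ n \<le> eval2 g (x, y)"
      using x by simp
  qed simp
  with c show ?thesis using that by blast
qed

lemma sublevel_sector_infinity_fmeasurable:
  assumes g: "g \<in> binary_forms (2 * Suc n)" and nn: "\<And>z. eval2 g z \<ge> 0"
    and "\<not> line_form (0, 1) ^ Suc n dvd g"
  obtains \<delta> where "\<delta> > 0" "{(x, y). eval2 g (x, y) \<le> 1 \<and> \<bar>x\<bar> < \<delta> * \<bar>y\<bar>} \<in> fmeasurable lborel"
proof -
  have "\<not> [:- 0, 1:] ^ Suc n dvd poly g 1"
    using line_form_infinity_power_dvd[OF g, of 1 "Suc n"] assms(3) by auto
  then obtain c \<delta> where c: "c > 0" "0 < \<delta>" "\<delta> \<le> 1"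
      "\<And>s. \<bar>s - 0\<bar> < \<delta> \<Longrightarrow> c * \<bar>s - 0\<bar> ^ n \<le> \<bar>poly (poly g 1) s\<bar>"
    using poly_lower_bound by blast
  have p: "poly (poly g 1) s = eval2 g (s, 1)" for s
    by (simp add: eval2_def one_pCons)
  have "{(x, y). eval2 g (prod.swap (x, y)) \<le> 1 \<and> \<bar>y - 0 * x\<bar> < \<delta> * \<bar>x\<bar>} \<in> fmeasurable lborel"
  proof (rule sublevel_cone_fmeasurable[OF _ c(1-3)])
    show "(\<lambda>x. eval2 g (prod.swap x)) \<in> borel_measurable borel"
      by (intro borel_measurable_continuous_onI continuous_intros continuous_on_swap)
    fix x y :: real assume x: "x \<noteq> 0" and y: "\<bar>y / x - 0\<bar> < \<delta>"
    have "c * \<bar>x\<bar> ^ (2 * Suc n) * \<bar>y / x - 0\<bar> ^ n = x ^ (2 * Suc n) * (c * \<bar>y / x - 0\<bar> ^ n)"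
      by (simp add: power_even_abs)
    also have "\<dots> \<le> x ^ (2 * Suc n) * eval2 g (y / x, 1)"
      using c(4)[OF y] nn[of "(y / x, 1)"]
      unfolding p by (intro mult_left_mono zero_le_even_power) auto
    also have "\<dots> = eval2 g (x * (y / x), x * 1)"
      by (rule eval2_scale[OF g, symmetric])
    finally show "c * \<bar>x\<bar> ^ (2 * Suc n) * \<bar>y / x - 0\<bar> ^ n \<le> eval2 g (prod.swap (x, y))"
      using x by simp
  qed
  from fmeasurable_swap[OF this]
  have "{(x, y). eval2 g (x, y) \<le> 1 \<and> \<bar>x\<bar> < \<delta> * \<bar>y\<bar>} \<in> fmeasurable lborel"
    by (rule back_subst[of "\<lambda>A. A \<in> fmeasurable lborel"]) auto
  with c show ?thesis using that by blast
qed

text \<open>Every direction has a sector of finite area, and compactness of an interval of slopes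
  reduces these to finitely many.\<close>

lemma finite_volume_if_not_line_form_power_dvd:
  assumes g: "g \<in> binary_forms (2 * Suc n)" and nn: "\<And>z. eval2 g z \<ge> 0"
    and ndvd: "\<And>z. z \<noteq> (0, 0) \<Longrightarrow> \<not> line_form z ^ Suc n dvd g"
  shows "{x. eval2 g x \<le> 1} \<in> fmeasurable lborel"
proof -
  let ?S = "\<lambda>t \<delta>. {(x, y). eval2 g (x, y) \<le> 1 \<and> \<bar>y - t * x\<bar> < \<delta> * \<bar>x\<bar>}"
  obtain \<eta> where \<eta>: "\<eta> > 0"
      "{(x, y). eval2 g (x, y) \<le> 1 \<and> \<bar>x\<bar> < \<eta> * \<bar>y\<bar>} \<in> fmeasurable lborel" (is "?T \<in> _")
    using sublevel_sector_infinity_fmeasurable[OF g nn] ndvd[of "(0, 1)"] by auto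
  have "\<exists>\<delta>. 0 < \<delta> \<and> ?S t \<delta> \<in> fmeasurable lborel" for t
    using sublevel_sector_fmeasurable[OF g nn, of t] ndvd[of "(1, t)"] by auto
  hence "\<exists>\<delta>. \<forall>t. 0 < \<delta> t \<and> ?S t (\<delta> t) \<in> fmeasurable lborel"
    by (intro choice allI)
  then obtain \<delta> where \<delta>: "\<And>t. \<delta> t > 0" "\<And>t. ?S t (\<delta> t) \<in> fmeasurable lborel"
    by blast
  \<comment> \<open>The sector \<open>?T\<close> leaves only points with
    \<open>\<eta> * \<bar>y\<bar> \<le> \<bar>x\<bar>\<close>, hence slopes in this compact
    interval.\<close>
  obtain C where C: "finite C" "{- (1 / \<eta>)..1 / \<eta>} \<subseteq> (\<Union>t\<in>C. ball t (\<delta> t))"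
  proof (rule compactE_image[of "{- (1 / \<eta>)..1 / \<eta>}" UNIV "\<lambda>t. ball t (\<delta> t)"])
    show "{- (1 / \<eta>)..1 / \<eta>} \<subseteq> (\<Union>t\<in>UNIV. ball t (\<delta> t))"
      using \<delta>(1) centre_in_ball by blast
  qed auto
  \<comment> \<open>The origin is listed separately because the strict inequalities exclude it from
    all sectors.\<close>
  have "{x. eval2 g x \<le> 1} \<subseteq> {(0, 0)} \<union> ?T \<union> (\<Union>t\<in>C. ?S t (\<delta> t))"
  proof (rule subsetI, rule ccontr)
    fix z assume "z \<in> {x. eval2 g x \<le> 1}"
      and *: "z \<notin> {(0, 0)} \<union> ?T \<union> (\<Union>t\<in>C. ?S t (\<delta> t))"
    obtain x y where z: "z = (x, y)" by (cases z)
    have le: "eval2 g (x, y) \<le> 1" and T: "(x, y) \<notin> ?T" and nz: "(x, y) \<noteq> (0, 0)"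
      and S: "\<And>t. t \<in> C \<Longrightarrow> (x, y) \<notin> ?S t (\<delta> t)"
      using * \<open>z \<in> _\<close> unfolding z by blast+
    have xy: "\<eta> * \<bar>y\<bar> \<le> \<bar>x\<bar>" using le T by auto
    have "x = 0"
    proof (rule ccontr)
      assume x: "x \<noteq> 0"
      have "\<bar>y / x\<bar> \<le> 1 / \<eta>"
        using xy x \<eta>(1) by (simp add: field_simps)
      hence "y / x \<in> {- (1 / \<eta>)..1 / \<eta>}"
        unfolding abs_le_iff by simp
      with C(2) obtain t where t: "t \<in> C" "y / x \<in> ball t (\<delta> t)"
        by blast
      hence "\<bar>y / x - t\<bar> < \<delta> t"
        by (simp add: dist_real_def abs_minus_commute)
      have "\<bar>y - t * x\<bar> = \<bar>y / x - t\<bar> * \<bar>x\<bar>"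
        by (rule abs_slope_diff[OF x])
      also have "\<dots> < \<delta> t * \<bar>x\<bar>"
        using \<open>\<bar>y / x - t\<bar> < \<delta> t\<close> x by (intro mult_strict_right_mono) auto
      finally show False using S[OF t(1)] le by auto
    qed
    moreover have "y = 0"
      using xy calculation \<eta>(1) by (simp add: mult_le_0_iff)
    ultimately show False using nz by simp
  qed
  moreover have "{(0, 0)} \<union> ?T \<union> (\<Union>t\<in>C. ?S t (\<delta> t)) \<in> fmeasurable lborel"
    using \<eta>(2) \<delta>(2) C(1)
    by (intro fmeasurable.Un fmeasurable.finite_UN) (auto intro!: fmeasurableI)
  moreover have "{x. eval2 g x \<le> 1} \<in> sets lborel" by measurable
  ultimately show ?thesis
    using fmeasurableI2 by blast
qed

section \<open>Forms with a negative value\<close>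

text \<open>A negative value persists on a disc of some radius \<open>e\<close>; scaling by
  \<open>c > 0\<close> multiplies values by \<open>c ^ d > 0\<close>, so the discs of radius
  \<open>c * e\<close> stay in the sublevel set.\<close>

lemma finite_volume_imp_nonneg:
  assumes "g \<in> finite_volume_forms d"
  shows "eval2 g z \<ge> 0"
proof (rule ccontr)
  assume "\<not> eval2 g z \<ge> 0"
  have g: "g \<in> binary_forms d" and fin: "emeasure lborel {x. eval2 g x \<le> 1} < \<infinity>"
    using assms by (auto simp: finite_volume_forms_def)
  have "open {x. eval2 g x < 0}"
    by (intro open_Collect_less continuous_intros)
  then obtain e where e: "e > 0" "ball z e \<subseteq> {x. eval2 g x < 0}"
    using \<open>\<not> eval2 g z \<ge> 0\<close> by (elim openE[of _ z]) auto
  have sub: "ball (c *\<^sub>R z) (c * e) \<subseteq> {x. eval2 g x \<le> 1}" if "c > 0" for c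
  proof
    fix x assume "x \<in> ball (c *\<^sub>R z) (c * e)"
    moreover have "dist (c *\<^sub>R z) x = c * dist z (x /\<^sub>R c)"
    proof -
      have "c *\<^sub>R z - x = c *\<^sub>R (z - x /\<^sub>R c)"
        using that by (simp add: scaleR_diff_right)
      thus ?thesis using that by (simp add: dist_norm)
    qed
    ultimately have "x /\<^sub>R c \<in> ball z e"
      using that by simp
    hence "eval2 g (x /\<^sub>R c) < 0" using e by auto
    moreover have "eval2 g x = c ^ d * eval2 g (x /\<^sub>R c)"
    proof -
      have "x = (c * fst (x /\<^sub>R c), c * snd (x /\<^sub>R c))"
        using that by (cases x) simp
      thus ?thesis
        using eval2_scale[OF g, of c "fst (x /\<^sub>R c)" "snd (x /\<^sub>R c)"]
        by (metis prod.collapse)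
    qed
    ultimately have "eval2 g x \<le> 0"
      using that by (simp add: mult_le_0_iff)
    thus "x \<in> {x. eval2 g x \<le> 1}" by simp
  qed
  have "{x. eval2 g x \<le> 1} \<in> sets lborel" by measurable
  hence le: "emeasure lborel (ball (c *\<^sub>R z) (c * e)) \<le> emeasure lborel {x. eval2 g x \<le> 1}"
    if "c > 0" for c
    using sub[OF that] by (intro emeasure_mono)
  obtain r where r: "r \<ge> 0" "emeasure lborel {x. eval2 g x \<le> 1} = ennreal r"
    using fin by (cases "emeasure lborel {x. eval2 g x \<le> 1}") auto
  have "pi * (c * e)\<^sup>2 \<le> r" if "c > 0" for c
    using le[OF that] r e that by (simp add: emeasure_ball unit_ball_vol_2 power2_eq_square)
  \<comment> \<open>This scaling gives radius \<open>r + 1\<close>, and a disc of that radius has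
    area greater than \<open>r\<close>.\<close>
  from this[of "(r + 1) / e"] have "pi * (r + 1)\<^sup>2 \<le> r"
    using e r by simp
  moreover have "1 * (r + 1) \<le> pi * (r + 1)\<^sup>2"
    using r pi_ge_two by (intro mult_mono) (auto simp: power2_eq_square)
  ultimately have "1 * (r + 1) \<le> r" by (rule order.trans[rotated])
  thus False by simp
qed

section \<open>The volume criterion and quartic forms\<close>

lemma finite_volume_iff:
  assumes "g \<in> nonneg_forms (2 * Suc n)"
  shows "g \<in> finite_volume_forms (2 * Suc n) \<longleftrightarrow>
    (\<forall>z. z \<noteq> (0, 0) \<longrightarrow> \<not> line_form z ^ Suc n dvd g)"
proof -
  have g: "g \<in> binary_forms (2 * Suc n)" and nn: "\<And>z. eval2 g z \<ge> 0"
    using assms unfolding nonneg_forms_def by auto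
  have "g \<in> finite_volume_forms (2 * Suc n) \<longleftrightarrow> emeasure lborel {x. eval2 g x \<le> 1} < \<infinity>"
    using g by (simp add: finite_volume_forms_def)
  moreover have "emeasure lborel {x. eval2 g x \<le> 1} = \<infinity>"
    if "z \<noteq> (0, 0)" "line_form z ^ Suc n dvd g" for z
    by (rule infinite_volume_if_line_form_power_dvd[OF g that])
  moreover have "emeasure lborel {x. eval2 g x \<le> 1} < \<infinity>"
    if "\<And>z. z \<noteq> (0, 0) \<Longrightarrow> \<not> line_form z ^ Suc n dvd g"
    using finite_volume_if_not_line_form_power_dvd[OF g nn that] by (auto simp: fmeasurable_def)
  ultimately show ?thesis
    by (metis less_irrefl)
qed

text \<open>Reconciles the criterion over all directions with an order condition at zeros only: the
  positive exponent \<open>Suc n\<close> supplies a factor vanishing at \<open>z\<close>.\<close>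

lemma eval2_zero_if_line_form_power_dvd:
  assumes "line_form z ^ Suc n dvd g"
  shows "eval2 g z = 0"
proof -
  have "eval2 (line_form z) z = 0"
    using eval2_line_form[of "fst z" "snd z" "fst z" "snd z"] by simp
  thus ?thesis
    using assms by (auto elim!: dvdE simp: eval2_mult eval2_power simp del: power_Suc)
qed

theorem theorem1p11:
  "(\<forall>d\<ge>2. even d \<longrightarrow> (\<forall>g \<in> nonneg_forms d.
      g \<in> finite_volume_forms d \<longleftrightarrow>
      (\<forall>z. z \<noteq> (0, 0) \<and> eval2 g z = 0 \<longrightarrow> zero_order g z \<le> enat (d div 2 - 1)))) \<and>
   finite_volume_forms 4 = positive_forms 4"
proof (intro conjI allI impI ballI)
  fix d :: nat and g
  assume "2 \<le> d" "even d" and g: "g \<in> nonneg_forms d"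
  define n where "n = d div 2 - 1"
  have d: "d = 2 * Suc n"
    using \<open>2 \<le> d\<close> \<open>even d\<close> by (auto simp: n_def)
  show "g \<in> finite_volume_forms d \<longleftrightarrow>
      (\<forall>z. z \<noteq> (0, 0) \<and> eval2 g z = 0 \<longrightarrow> zero_order g z \<le> enat (d div 2 - 1))"
    unfolding zero_order_le_iff n_def[symmetric]
    using finite_volume_iff[of g n] g eval2_zero_if_line_form_power_dvd[of _ n g]
    unfolding d by blast
next
  \<comment> \<open>For \<open>n = 1\<close> the forbidden divisor is the square of a linear form,
    and every nontrivial zero of a non-negative form produces one.\<close>
  have eq: "g \<in> finite_volume_forms 4 \<longleftrightarrow> (\<forall>z. z \<noteq> (0, 0) \<longrightarrow> eval2 g z \<noteq> 0)"
    if "g \<in> nonneg_forms 4" for g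
  proof -
    have e: "Suc 1 = (2::nat)" "2 * 2 = (4::nat)" by simp_all
    show ?thesis
      using finite_volume_iff[of g 1, unfolded e, OF that] square_line_form_dvd[OF that]
        eval2_zero_if_line_form_power_dvd[of _ 1 g, unfolded e] by blast
  qed
  have "positive_forms 4 = {g \<in> nonneg_forms 4. \<forall>z. z \<noteq> (0, 0) \<longrightarrow> eval2 g z \<noteq> 0}"
  proof -
    \<comment> \<open>Scaling by 0 settles the origin, where \<open>positive_forms\<close> demands
      nothing but \<open>nonneg_forms\<close> does.\<close>
    have "eval2 g (0, 0) = 0" if "g \<in> binary_forms 4" for g
      using eval2_scale[OF that, of 0 0 0] by simp
    thus ?thesis
      unfolding positive_forms_def nonneg_forms_def
      by (auto simp: order.strict_iff_order) (metis order.refl order.strict_iff_order)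
  qed
  moreover have "finite_volume_forms 4 \<subseteq> nonneg_forms 4"
    using finite_volume_imp_nonneg by (auto simp: nonneg_forms_def finite_volume_forms_def)
  ultimately show "finite_volume_forms 4 = positive_forms 4"
    using eq by auto
qed

end
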